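(* For all $k\geq1$, $\epsilon>0$ and non-increasing $f:\mathbb{N}\to(0,1]$, there is $M=M(k,\epsilon,f)$ such that the following holds. Suppose $G=(V,E)$ is a finite $k$-stable graph. Then there are $m\leq M$ and a partition $V=W_0\cup W_1\cup\dots\cup W_m$ such that $|W_0|\leq\epsilon|V|$, and such that for all $1\leq i,j\leq m$, $(W_i,W_j)$ satisfies $\mathrm{disc}_2(f(m))$ and $|W_i|=|W_j|$.
   Context: A graph $G=(V,E)$ has the $k$-order property if there are $a_1,\dots,a_k,b_1,\dots,b_k\in V$ such that $a_ib_j\in E$ if and only if $i\leq j$; otherwise $G$ is $k$-stable. For $X,Y\subseteq V$ let $e(X,Y)$ be the number of ordered pairs $(x,y)\in X\times Y$ with $xy\in E$, and let $d=e(X,Y)/(|X||Y|)$. The pair $(X,Y)$ satisfies $\mathrm{disc}_2(\epsilon')$ if for all $X'\subseteq X$ and $Y'\subseteq Y$, $|e(X',Y')-d|X'||Y'||\leq\epsilon'|X||Y|$. *)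

theory Defs
  imports Complex_Main "HOL-Library.Disjoint_Sets" "Graph_Theory.Pair_Digraph"
begin

text \<open>
  A finite simple graph is a \<open>pair_graph\<close>: a finite vertex set with a finite, symmetric and
  loop-free set of ordered pairs of vertices, so that \<open>xy\<close> is an edge iff
  \<open>(x, y) \<in> parcs G\<close>.
\<close>

definition has_order_property :: "'a pair_pre_digraph \<Rightarrow> nat \<Rightarrow> bool" where
  "has_order_property G k \<longleftrightarrow>
     (\<exists>a b :: nat \<Rightarrow> 'a.
        (\<forall>i\<in>{1..k}. a i \<in> pverts G \<and> b i \<in> pverts G) \<and>
        (\<forall>i\<in>{1..k}. \<forall>j\<in>{1..k}. (a i, b j) \<in> parcs G \<longleftrightarrow> i \<le> j))"

definition stable_graph :: "nat \<Rightarrow> 'a pair_pre_digraph \<Rightarrow> bool" where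
  "stable_graph k G \<longleftrightarrow> \<not> has_order_property G k"

text \<open>Ordered pairs are counted, so an edge inside \<open>X \<inter> Y\<close> contributes twice.\<close>

definition edge_count :: "'a pair_pre_digraph \<Rightarrow> 'a set \<Rightarrow> 'a set \<Rightarrow> nat" where
  "edge_count G X Y = card {(x, y) \<in> X \<times> Y. (x, y) \<in> parcs G}"

definition edge_density :: "'a pair_pre_digraph \<Rightarrow> 'a set \<Rightarrow> 'a set \<Rightarrow> real" where
  "edge_density G X Y = real (edge_count G X Y) / (real (card X) * real (card Y))"

definition disc2 :: "'a pair_pre_digraph \<Rightarrow> real \<Rightarrow> 'a set \<Rightarrow> 'a set \<Rightarrow> bool" where
  "disc2 G \<delta> X Y \<longleftrightarrow>
     (\<forall>X' Y'. X' \<subseteq> X \<longrightarrow> Y' \<subseteq> Y \<longrightarrow>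
        \<bar>real (edge_count G X' Y') - edge_density G X Y * real (card X') * real (card Y')\<bar>
          \<le> \<delta> * real (card X) * real (card Y))"

text \<open>
  A partition \<open>V = W 0 \<union> W 1 \<union> \<dots> \<union> W m\<close> with exceptional set \<open>W 0\<close>. Only the exceptional set
  may be empty; values \<open>W i\<close> with \<open>i > m\<close> are irrelevant.
\<close>

definition exceptional_partition :: "'a set \<Rightarrow> nat \<Rightarrow> (nat \<Rightarrow> 'a set) \<Rightarrow> bool" where
  "exceptional_partition V m W \<longleftrightarrow>
     V = (\<Union>i\<in>{0..m}. W i) \<and> disjoint_family_on W {0..m} \<and> (\<forall>i\<in>{1..m}. W i \<noteq> {})"

end

theory Submission
  imports Defs
begin

text \<open>
  Call \<open>S\<close> good if every vertex is adjacent to almost all or to almost none of \<open>S\<close>. Double counting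
  shows that two good sets have density close to 0 or 1, which gives \<open>disc\<^sub>2\<close>, and large subsets
  of good sets are good, so it suffices to cover most of \<open>V\<close> by boundedly many sets whose quality may
  depend on their number. By stability, sets have a bounded rank (the depth of binary trees of
  neighbourhood splittings), and when a vertex splits a set, one of the parts has smaller rank.
  From each class of a partition into \<open>t\<close> classes, split off parts of smaller rank until the rest is
  good at level \<open>\<eta> t\<close> or tiny. If few vertices were split off altogether, discard them and stop.
  Otherwise refine the partition accordingly and repeat; the sum over the vertices of the ranks of their
  classes drops by a fixed proportion of \<open>|V|\<close>, so this happens boundedly often.
\<close>

section \<open>Binary trees of neighbourhood splittings and the half-graphs inside them\<close>

text \<open>Encodes a complete binary tree of depth \<open>n\<close>: inner nodes carry vertices of
  \<open>B\<close>, and each leaf is realised by a vertex of \<open>L\<close> whose adjacencies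
  follow the path to it. Nodes on one level may carry different vertices, so this is shattering as
  in Littlestone dimension rather than VC dimension.\<close>

primrec branching :: "'a rel \<Rightarrow> 'a set \<Rightarrow> nat \<Rightarrow> 'a set \<Rightarrow> bool" where
  "branching r B 0 L \<longleftrightarrow> L \<noteq> {}"
| "branching r B (Suc n) L \<longleftrightarrow>
     (\<exists>b\<in>B. branching r B n {x\<in>L. (x, b) \<in> r} \<and> branching r B n {x\<in>L. (x, b) \<notin> r})"

lemma branching_mono:
  "branching r B n L \<Longrightarrow> B \<subseteq> B' \<Longrightarrow> L \<subseteq> L' \<Longrightarrow> branching r B' n L'"
proof (induction n arbitrary: L L')
  case 0
  then show ?case by auto
next
  case (Suc n)
  then obtain b where b: "b \<in> B" "branching r B n {x\<in>L. (x, b) \<in> r}" "branching r B n {x\<in>L. (x, b) \<notin> r}"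
    by auto
  have "branching r B' n {x\<in>L'. (x, b) \<in> r}" "branching r B' n {x\<in>L'. (x, b) \<notin> r}"
    using Suc.IH[OF b(2) Suc.prems(2), of "{x\<in>L'. (x, b) \<in> r}"]
      Suc.IH[OF b(3) Suc.prems(2), of "{x\<in>L'. (x, b) \<notin> r}"] Suc.prems(3) by blast+
  then show ?case using b(1) Suc.prems(2) by auto
qed

lemma branching_Suc_D: "branching r B (Suc n) L \<Longrightarrow> branching r B n L"
  using branching_mono[of r B n _ B L] by auto

lemma branching_le: "branching r B n L \<Longrightarrow> m \<le> n \<Longrightarrow> branching r B m L"
  by (induction n) (auto simp: le_Suc_eq simp del: branching.simps dest: branching_Suc_D)

lemma branching_nonempty: "branching r B n L \<Longrightarrow> L \<noteq> {}"
  using branching_le[of r B n L 0] by simp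

text \<open>A Ramsey argument for trees whose nodes are coloured \<open>R\<close> or
  \<open>S\<close>. Suppose the root lies in \<open>R\<close>. If one of the two subtrees contains
  an \<open>S\<close>-tree of depth \<open>m\<close>, this suffices; otherwise both contain
  \<open>R\<close>-trees of depth \<open>n - 1\<close>, and the root joins them. A root in
  \<open>S\<close> is symmetric.\<close>

lemma branching_Un:
  "branching r (R \<union> S) (n + m) L \<Longrightarrow> branching r R n L \<or> branching r S m L"
proof (induction "n + m" arbitrary: n m L)
  case 0
  then show ?case by auto
next
  case (Suc s)
  show ?case
  proof (cases "n = 0 \<or> m = 0")
    case True
    then show ?thesis using branching_nonempty[OF Suc.prems] by auto
  next
    case False
    then obtain n' m' where nm: "n = Suc n'" "m = Suc m'" by (metis not0_implies_Suc)
    obtain b where b: "b \<in> R \<union> S" "branching r (R \<union> S) s {x\<in>L. (x, b) \<in> r}"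
      "branching r (R \<union> S) s {x\<in>L. (x, b) \<notin> r}"
      using Suc.prems Suc.hyps(2)[symmetric] by auto
    have s: "s = n' + m" "s = n + m'" using nm Suc.hyps(2) by auto
    have mono: "branching r Q i {x\<in>L. (x, b) \<in> r} \<Longrightarrow> branching r Q i L"
      "branching r Q i {x\<in>L. (x, b) \<notin> r} \<Longrightarrow> branching r Q i L" for Q i
      by (erule branching_mono; auto)+
    show ?thesis
    proof (cases "b \<in> R")
      case True
      show ?thesis
        using Suc.hyps(1)[OF s(1), of "{x\<in>L. (x, b) \<in> r}"] Suc.hyps(1)[OF s(1), of "{x\<in>L. (x, b) \<notin> r}"]
          b(2,3) s(1) mono[of S m] True nm(1) by (simp only: branching.simps) blast
    next
      case False
      then have "b \<in> S" using b by auto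
      then show ?thesis
        using Suc.hyps(1)[OF s(2), of "{x\<in>L. (x, b) \<in> r}"] Suc.hyps(1)[OF s(2), of "{x\<in>L. (x, b) \<notin> r}"]
          b(2,3) s(2) mono[of R n] \<open>b \<in> S\<close> nm(2) by (simp only: branching.simps) blast
    qed
  qed
qed

text \<open>The depth that Hodges' argument needs to extract a half-graph of size \<open>k\<close>.\<close>

primrec hodges_height :: "nat \<Rightarrow> nat" where
  "hodges_height 0 = 0"
| "hodges_height (Suc k) = 2 * hodges_height k + 2"

text \<open>
  In the subtree of neighbours of the root, colour the nodes by adjacency to one leaf \<open>x\<close>. A deep
  tree of neighbours of \<open>x\<close> yields a half-graph that can be extended in front, a deep tree of
  non-neighbours one that can be extended at the end.
\<close>

lemma branching_imp_half_graph:
  assumes "branching r B (hodges_height k) L"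
  shows "\<exists>a b. (\<forall>i<k. a i \<in> L \<and> b i \<in> B) \<and> (\<forall>i<k. \<forall>j<k. (a i, b j) \<in> r \<longleftrightarrow> i \<le> j)"
  using assms
proof (induction k arbitrary: B L)
  case 0
  then show ?case by simp
next
  case (Suc k)
  let ?h = "hodges_height k"
  \<comment> \<open>One level of the height pays for the root \<open>y\<close>; the others are
    divided so that the neighbours of \<open>x\<close> get a spare level.\<close>
  obtain y where y: "y \<in> B" "branching r B (Suc ?h + ?h) {x\<in>L. (x, y) \<in> r}"
    using Suc.prems by (auto simp: mult_2)
  let ?L = "{x\<in>L. (x, y) \<in> r}"
  obtain x where x: "x \<in> ?L" using branching_nonempty[OF y(2)] by blast
  let ?R = "{b\<in>B. (x, b) \<in> r}" and ?S = "{b\<in>B. (x, b) \<notin> r}"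
  have "?R \<union> ?S = B" by auto
  then consider "branching r ?R (Suc ?h) ?L" | "branching r ?S ?h ?L"
    using branching_Un[of r ?R ?S "Suc ?h" ?h ?L] y(2) by auto
  then show ?case
  proof cases
    case 1
    \<comment> \<open>The spare level supplies \<open>z\<close>, which is adjacent to
      \<open>x\<close> but to none of the remaining leaves. So \<open>x\<close> and \<open>z\<close>
      can become the first pair.\<close>
    then obtain z where z: "z \<in> ?R" "branching r ?R ?h {u\<in>?L. (u, z) \<notin> r}" by auto
    obtain a b where ab: "\<forall>i<k. a i \<in> {u\<in>?L. (u, z) \<notin> r} \<and> b i \<in> ?R"
      "\<forall>i<k. \<forall>j<k. (a i, b j) \<in> r \<longleftrightarrow> i \<le> j"
      using Suc.IH[OF z(2)] by blast
    have 1: "\<forall>i<Suc k. case_nat x a i \<in> L \<and> case_nat z b i \<in> B"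
      using ab(1) x z(1) by (simp add: All_less_Suc2)
    have 2: "\<forall>i<Suc k. \<forall>j<Suc k. (case_nat x a i, case_nat z b j) \<in> r \<longleftrightarrow> i \<le> j"
      using ab z(1) by (simp add: All_less_Suc2)
    show ?thesis by (rule exI[of _ "case_nat x a"], rule exI[of _ "case_nat z b"]) (rule conjI[OF 1 2])
  next
    case 2
    \<comment> \<open>Here \<open>x\<close> misses every \<open>b i\<close>, while \<open>y\<close>
      is adjacent to \<open>x\<close> and to every \<open>a i\<close>. So \<open>x\<close> and
      \<open>y\<close> can become the last pair.\<close>
    obtain a b where ab: "\<forall>i<k. a i \<in> ?L \<and> b i \<in> ?S"
      "\<forall>i<k. \<forall>j<k. (a i, b j) \<in> r \<longleftrightarrow> i \<le> j"
      using Suc.IH[OF 2] by blast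
    have 1: "\<forall>i<Suc k. (a(k := x)) i \<in> L \<and> (b(k := y)) i \<in> B"
      using ab(1) x y(1) by (simp add: All_less_Suc)
    have 2: "\<forall>i<Suc k. \<forall>j<Suc k. ((a(k := x)) i, (b(k := y)) j) \<in> r \<longleftrightarrow> i \<le> j"
      using ab x by (simp add: All_less_Suc)
    show ?thesis by (rule exI[of _ "a(k := x)"], rule exI[of _ "b(k := y)"]) (rule conjI[OF 1 2])
  qed
qed

lemma stable_graph_not_branching:
  assumes "stable_graph k G"
  shows "\<not> branching (parcs G) (pverts G) (hodges_height k) (pverts G)"
proof
  assume "branching (parcs G) (pverts G) (hodges_height k) (pverts G)"
  from branching_imp_half_graph[OF this] obtain a b where
    ab: "\<forall>i<k. a i \<in> pverts G \<and> b i \<in> pverts G"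
    "\<forall>i<k. \<forall>j<k. (a i, b j) \<in> parcs G \<longleftrightarrow> i \<le> j" by blast
  have "has_order_property G k"
    unfolding has_order_property_def
    by (rule exI[of _ "\<lambda>i. a (i - 1)"], rule exI[of _ "\<lambda>i. b (i - 1)"])
      (use ab in \<open>auto simp: Suc_le_eq\<close>)
  then show False using assms by (simp add: stable_graph_def)
qed

section \<open>The rank of a vertex set\<close>

text \<open>The first impossible depth: 0 for the empty set, and otherwise one more than the
  Littlestone dimension (Shelah's 2-rank). The \<open>LEAST\<close> is meaningful only if some depth
  is impossible, which the next locale guarantees for subsets of \<open>V\<close>.\<close>

definition branching_rank :: "'a rel \<Rightarrow> 'a set \<Rightarrow> 'a set \<Rightarrow> nat" where
  "branching_rank r V A = (LEAST n. \<not> branching r V n A)"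

text \<open>Stability enters all later arguments only through the bound \<open>h\<close>, which is
  \<open>hodges_height k\<close> in the application.\<close>

locale bounded_branching =
  fixes r :: "'a rel" and V :: "'a set" and h :: nat
  assumes finite_V [simp]: "finite V" and not_branching: "\<not> branching r V h V"
begin

abbreviation rk :: "'a set \<Rightarrow> nat" where "rk \<equiv> branching_rank r V"

lemma not_branching_subset: "A \<subseteq> V \<Longrightarrow> \<not> branching r V h A"
  using not_branching branching_mono[of r V h A V V] by auto

lemma not_branching_rk: "A \<subseteq> V \<Longrightarrow> \<not> branching r V (rk A) A"
  unfolding branching_rank_def by (rule LeastI) (rule not_branching_subset)

lemma rk_le_iff: "A \<subseteq> V \<Longrightarrow> rk A \<le> n \<longleftrightarrow> \<not> branching r V n A"
  using not_branching_rk[of A] branching_le[of r V n A "rk A"]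
  by (auto simp: branching_rank_def intro: Least_le)

lemma rk_le: "A \<subseteq> V \<Longrightarrow> rk A \<le> h"
  using rk_le_iff not_branching_subset by blast

lemma rk_mono: "A \<subseteq> B \<Longrightarrow> B \<subseteq> V \<Longrightarrow> rk A \<le> rk B"
  using rk_le_iff[of A] not_branching_rk[of B] branching_mono[of r V _ A V B] by blast

text \<open>If both parts kept the rank \<open>Suc n\<close> of \<open>A\<close>, each would carry a
  tree of depth \<open>n\<close>, and \<open>b\<close> as a root would join them to a tree of depth
  \<open>Suc n\<close> in \<open>A\<close>.\<close>

lemma rk_split:
  assumes "A \<subseteq> V" "A \<noteq> {}" "b \<in> V"
  shows "rk {x\<in>A. (x, b) \<in> r} < rk A \<or> rk {x\<in>A. (x, b) \<notin> r} < rk A"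
proof -
  obtain n where n: "rk A = Suc n"
    using not_branching_rk[OF assms(1)] assms(2) by (cases "rk A") auto
  then have "\<not> branching r V n {x\<in>A. (x, b) \<in> r} \<or> \<not> branching r V n {x\<in>A. (x, b) \<notin> r}"
    using not_branching_rk[OF assms(1)] assms(3) by auto
  moreover have "{x\<in>A. (x, b) \<in> r} \<subseteq> V" "{x\<in>A. (x, b) \<notin> r} \<subseteq> V" using assms(1) by auto
  ultimately show ?thesis
    using rk_le_iff[of "{x\<in>A. (x, b) \<in> r}" n] rk_le_iff[of "{x\<in>A. (x, b) \<notin> r}" n]
    by (auto simp: n less_Suc_eq_le)
qed

section \<open>Good sets, and splitting off parts of smaller rank\<close>

text \<open>The good sets of Malliaris and Shelah. The vertex \<open>b\<close> ranges over all of
  \<open>V\<close> and always stands in the second coordinate.\<close>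

definition good :: "real \<Rightarrow> 'a set \<Rightarrow> bool" where
  "good \<eta> S \<longleftrightarrow> (\<forall>b\<in>V. real (card {x\<in>S. (x, b) \<in> r}) \<le> \<eta> * card S \<or>
                     real (card {x\<in>S. (x, b) \<notin> r}) \<le> \<eta> * card S)"

text \<open>The exceptional vertices can only become fewer in \<open>B\<close>, so the quality
  worsens at most by the ratio of the two sizes.\<close>

lemma good_subset:
  assumes "good \<eta> S" "B \<subseteq> S" "finite S" "\<eta> * real (card S) \<le> \<eta>' * real (card B)"
  shows "good \<eta>' B"
  unfolding good_def
proof
  fix b assume "b \<in> V"
  have "card {x\<in>B. (x, b) \<in> r} \<le> card {x\<in>S. (x, b) \<in> r}" "card {x\<in>B. (x, b) \<notin> r} \<le> card {x\<in>S. (x, b) \<notin> r}"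
    using assms by (auto intro!: card_mono)
  then show "real (card {x\<in>B. (x, b) \<in> r}) \<le> \<eta>' * real (card B) \<or> real (card {x\<in>B. (x, b) \<notin> r}) \<le> \<eta>' * real (card B)"
    using assms(1,4) \<open>b \<in> V\<close> unfolding good_def by force
qed

text \<open>The label \<open>l\<close> records a process of \<open>n\<close> rounds: label 0 marks
  what remains, a positive label the round in which a vertex was split off. A remainder that is
  neither good nor small is split by some \<open>b\<close> into two parts, both larger than
  \<open>\<eta> * c\<close>; the one of smaller rank is removed. The last alternative measures this
  progress.\<close>

lemma peel_aux:
  assumes "A \<subseteq> V" "\<eta> > 0" "c > 0"
  shows "\<exists>l. (\<forall>v\<in>A. l v \<le> n) \<and> (\<forall>v\<in>A. l v \<noteq> 0 \<longrightarrow> rk {u\<in>A. l u = l v} < rk A) \<and>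
           (good \<eta> {v\<in>A. l v = 0} \<or> real (card {v\<in>A. l v = 0}) < c \<or>
            real (card {v\<in>A. l v = (0::nat)}) \<le> card A - real n * (\<eta> * c))"
proof (induction n)
  case 0
  show ?case by (rule exI[of _ "\<lambda>_. 0"]) auto
next
  case (Suc n)
  then obtain l where l: "\<forall>v\<in>A. l v \<le> n" "\<forall>v\<in>A. l v \<noteq> 0 \<longrightarrow> rk {u\<in>A. l u = l v} < rk A"
    and or: "good \<eta> {v\<in>A. l v = 0} \<or> real (card {v\<in>A. l v = 0}) < c \<or>
            real (card {v\<in>A. l v = (0::nat)}) \<le> card A - real n * (\<eta> * c)" by blast
  define S where "S = {v\<in>A. l v = 0}"
  have fin: "finite A" using assms(1) finite_V finite_subset by blast
  show ?case
  proof (cases "good \<eta> S \<or> card S < c")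
    case True
    then show ?thesis using l S_def by (intro exI[of _ l]) (auto simp: le_SucI)
  next
    case False
    then have Sc: "card S \<ge> c" and le: "card S \<le> card A - real n * (\<eta> * c)" using or by (auto simp: S_def)
    have "S \<noteq> {}" using Sc assms(3) by auto
    have "S \<subseteq> A" by (auto simp: S_def)
    then have SV: "S \<subseteq> V" "finite S" using assms(1) fin finite_subset by blast+
    obtain b where b: "b \<in> V" "card {x\<in>S. (x, b) \<in> r} > \<eta> * card S" "card {x\<in>S. (x, b) \<notin> r} > \<eta> * card S"
      using False by (force simp: good_def)
    \<comment> \<open>Failure of goodness makes both sides large, so the side can be chosen by rank
      alone.\<close>
    define Q where "Q = (if rk {x\<in>S. (x, b) \<in> r} < rk S then {x\<in>S. (x, b) \<in> r} else {x\<in>S. (x, b) \<notin> r})"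
    have Q: "Q \<subseteq> S" "rk Q < rk S" "card Q > \<eta> * card S"
      using rk_split[OF SV(1) \<open>S \<noteq> {}\<close> b(1)] b by (auto simp: Q_def)
    have "rk S \<le> rk A" using rk_mono[OF \<open>S \<subseteq> A\<close> assms(1)] .
    define l' where "l' = (\<lambda>v. if v \<in> Q then Suc n else l v)"
    have Qeq: "{u\<in>A. l' u = Suc n} = Q"
      using Q(1) \<open>S \<subseteq> A\<close> l(1) by (auto simp: l'_def)
    have S': "{v\<in>A. l' v = 0} = S - Q" by (auto simp: l'_def S_def)
    have "card (S - Q) = real (card S) - card Q"
      using Q(1) SV(2) by (simp add: card_Diff_subset finite_subset card_mono of_nat_diff)
    moreover have "\<eta> * c \<le> \<eta> * card S" using Sc assms(2) by simp
    ultimately have "card (S - Q) \<le> card A - real (Suc n) * (\<eta> * c)"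
      using le Q(3) by (simp add: algebra_simps)
    moreover have "rk {u\<in>A. l' u = l' v} < rk A" if v: "v \<in> A" "l' v \<noteq> 0" for v
    proof (cases "v \<in> Q")
      case True
      then show ?thesis using Qeq Q(2) \<open>rk S \<le> rk A\<close> by (simp add: l'_def)
    next
      case False
      then have "l v \<noteq> 0" and "l' v = l v" using v by (auto simp: l'_def)
      have "{u\<in>A. l' u = l v} \<subseteq> {u\<in>A. l u = l v}"
        using l(1) v(1) by (auto simp: l'_def split: if_splits)
      then have "rk {u\<in>A. l' u = l v} \<le> rk {u\<in>A. l u = l v}"
        by (rule rk_mono) (use assms(1) in auto)
      also have "\<dots> < rk A" using l(2) v(1) \<open>l v \<noteq> 0\<close> by blast
      finally show ?thesis using \<open>l' v = l v\<close> by simp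
    qed
    moreover have "\<forall>v\<in>A. l' v \<le> Suc n" using l(1) by (auto simp: l'_def le_SucI)
    ultimately show ?thesis using S' by (intro exI[of _ l'] conjI ballI impI) simp_all
  qed
qed

text \<open>With this many rounds the last alternative of \<open>peel_aux\<close> would leave a
  negative number of vertices.\<close>

lemma peel:
  assumes "A \<subseteq> V" "\<eta> > 0" "\<theta> > 0" "real N * (\<eta> * \<theta>) > 1"
  shows "\<exists>l::'a \<Rightarrow> nat. (\<forall>v\<in>A. l v \<le> N) \<and> (\<forall>v\<in>A. l v \<noteq> 0 \<longrightarrow> rk {u\<in>A. l u = l v} < rk A) \<and>
           (good \<eta> {v\<in>A. l v = 0} \<or> real (card {v\<in>A. l v = 0}) < \<theta> * card V)"
\<comment> \<open>The threshold \<open>\<theta> * card V\<close> must be positive for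
  \<open>peel_aux\<close>.\<close>
proof (cases "V = {}")
  case True
  then have "good \<eta> {v\<in>A. l v = 0}" for l :: "'a \<Rightarrow> nat" unfolding good_def using True by simp
  then show ?thesis using True assms(1) by (intro exI[of _ "\<lambda>_. 0"]) auto
next
  case False
  then have V: "card V > 0" by (simp add: card_gt_0_iff)
  have "card A \<le> card V" using assms(1) by (simp add: card_mono)
  moreover have "1 * real (card V) < real N * (\<eta> * \<theta>) * card V"
    using assms(4) V by (intro mult_strict_right_mono) auto
  ultimately have "real (card A) - real N * (\<eta> * (\<theta> * card V)) < 0"
    by (simp add: mult_ac)
  then show ?thesis
    using peel_aux[OF assms(1,2), of "\<theta> * card V" N] assms(3) V
    by (smt (verit) mult_pos_pos of_nat_0_le_iff of_nat_0_less_iff)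
qed

section \<open>Refining colourings until few vertices are split off\<close>

definition potential :: "('a \<Rightarrow> nat) \<Rightarrow> nat" where
  "potential c = (\<Sum>v\<in>V. rk {u\<in>V. c u = c v})"

text \<open>\<open>D\<close> collects the vertices split off from all classes. Each of them moves to
  a class of smaller rank and the other ranks do not grow, hence the drop by \<open>card D\<close>.
  The last claim concerns the old colouring \<open>c\<close>: if \<open>D\<close> is small,
  \<open>c\<close> with \<open>D\<close> discarded is already the answer, and \<open>c'\<close>
  serves only to continue.\<close>

lemma refine_colouring:
  fixes c :: "'a \<Rightarrow> nat"
  assumes "\<eta> > 0" "\<theta> > 0" "real N * (\<eta> * \<theta>) > 1" "c ` V \<subseteq> {..<T}"
  obtains c' D where "c' ` V \<subseteq> {..<T * Suc N}" "D \<subseteq> V" "potential c' + card D \<le> potential c"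
    "\<And>i. good \<eta> {v\<in>V - D. c v = i} \<or> real (card {v\<in>V - D. c v = i}) < \<theta> * card V"
proof -
  have "\<forall>i. \<exists>l::'a \<Rightarrow> nat. (\<forall>v\<in>{v\<in>V. c v = i}. l v \<le> N) \<and>
     (\<forall>v\<in>{v\<in>V. c v = i}. l v \<noteq> 0 \<longrightarrow> rk {u\<in>{v\<in>V. c v = i}. l u = l v} < rk {v\<in>V. c v = i}) \<and>
     (good \<eta> {v\<in>{v\<in>V. c v = i}. l v = 0} \<or> real (card {v\<in>{v\<in>V. c v = i}. l v = 0}) < \<theta> * card V)"
    by (intro allI peel[OF _ assms(1-3)]) auto
  then obtain l :: "nat \<Rightarrow> 'a \<Rightarrow> nat" where l:
    "\<And>i v. v \<in> V \<Longrightarrow> c v = i \<Longrightarrow> l i v \<le> N"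
    "\<And>i v. v \<in> V \<Longrightarrow> c v = i \<Longrightarrow> l i v \<noteq> 0 \<Longrightarrow> rk {u\<in>{v\<in>V. c v = i}. l i u = l i v} < rk {v\<in>V. c v = i}"
    "\<And>i. good \<eta> {v\<in>{v\<in>V. c v = i}. l i v = 0} \<or> real (card {v\<in>{v\<in>V. c v = i}. l i v = 0}) < \<theta> * card V"
    by (auto dest!: choice)
  define D where "D = {v\<in>V. l (c v) v \<noteq> 0}"
  \<comment> \<open>The pair of old colour and label, written as one number in base
    \<open>Suc N\<close>; labels are at most \<open>N\<close>, so this is injective on
    pairs.\<close>
  define c' where "c' = (\<lambda>v. c v * Suc N + l (c v) v)"
  have c'_eq: "c' u = c' v \<longleftrightarrow> c u = c v \<and> l (c u) u = l (c v) v" if "u \<in> V" "v \<in> V" for u v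
  proof
    assume eq: "c' u = c' v"
    have "c' w div Suc N = c w" "c' w mod Suc N = l (c w) w" if "w \<in> V" for w
    proof -
      define K where "K = Suc N"
      have "l (c w) w < K" using l(1)[OF that refl] by (simp add: K_def)
      then show "c' w div Suc N = c w" "c' w mod Suc N = l (c w) w"
        unfolding c'_def K_def[symmetric] by simp_all
    qed
    then show "c u = c v \<and> l (c u) u = l (c v) v" using eq that by metis
  qed (auto simp: c'_def)
  show thesis
  proof (rule that[of c' D])
    show "c' ` V \<subseteq> {..<T * Suc N}"
    proof (rule image_subsetI)
      fix v assume v: "v \<in> V"
      then have "c' v < Suc (c v) * Suc N" using l(1)[OF v refl] by (simp add: c'_def)
      also have "\<dots> \<le> T * Suc N" using assms(4) v by (intro mult_le_mono1) auto
      finally show "c' v \<in> {..<T * Suc N}" by simp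
    qed
    show "D \<subseteq> V" by (auto simp: D_def)
    have "rk {u\<in>V. c' u = c' v} + (if v \<in> D then 1 else 0) \<le> rk {u\<in>V. c u = c v}" if v: "v \<in> V" for v
    proof -
      have eq: "{u\<in>V. c' u = c' v} = {u\<in>{w\<in>V. c w = c v}. l (c v) u = l (c v) v}"
        using c'_eq v by auto
      show ?thesis
      proof (cases "v \<in> D")
        case True
        then show ?thesis using l(2)[OF v refl] by (simp add: eq D_def)
      next
        case False
        then show ?thesis unfolding eq by (auto intro!: rk_mono)
      qed
    qed
    then have "(\<Sum>v\<in>V. rk {u\<in>V. c' u = c' v} + (if v \<in> D then 1 else 0)) \<le> potential c"
      unfolding potential_def by (rule sum_mono)
    then show "potential c' + card D \<le> potential c"
      using \<open>D \<subseteq> V\<close> by (simp add: potential_def sum.distrib Int_absorb1 flip: sum.inter_restrict)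
    fix i
    have "{v\<in>V - D. c v = i} = {v\<in>{v\<in>V. c v = i}. l i v = 0}" by (auto simp: D_def)
    then show "good \<eta> {v\<in>V - D. c v = i} \<or> real (card {v\<in>V - D. c v = i}) < \<theta> * card V"
      using l(3)[of i] by simp
  qed
qed

end

text \<open>\<open>j\<close> is a budget in units of \<open>\<delta> * card V\<close>. A round that
  splits off more than one unit lowers the potential by more than a unit; any other round ends the
  process. The number of colours in each round depends only on \<open>T\<close>, \<open>j\<close>
  and the parameter functions, so \<open>M\<close> can be fixed before the graph.\<close>

lemma good_colouring_bounded_potential:
  fixes \<delta> :: real and \<eta> \<theta> :: "nat \<Rightarrow> real"
  assumes pos: "\<And>t. \<eta> t > 0" "\<And>t. \<theta> t > 0" and "\<delta> > 0"
  shows "\<exists>M. \<forall>(r :: 'a rel) V h (c :: 'a \<Rightarrow> nat). bounded_branching r V h \<longrightarrow> c ` V \<subseteq> {..<T} \<longrightarrow>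
     real (bounded_branching.potential r V c) \<le> real j * (\<delta> * card V) \<longrightarrow>
     (\<exists>t\<le>M. \<exists>(c :: 'a \<Rightarrow> nat) D. c ` V \<subseteq> {..<t} \<and> D \<subseteq> V \<and> real (card D) \<le> \<delta> * card V \<and>
       (\<forall>i. bounded_branching.good r V (\<eta> t) {v\<in>V - D. c v = i} \<or>
            real (card {v\<in>V - D. c v = i}) < \<theta> t * card V))"
    (is "\<exists>M. ?P M T j")
proof (induction j arbitrary: T rule: less_induct)
  case (less j)
  obtain N :: nat where "real N > 1 / (\<eta> T * \<theta> T)" using reals_Archimedean2 by blast
  then have N: "real N * (\<eta> T * \<theta> T) > 1" using pos by (simp add: field_simps)
  \<comment> \<open>The guard is needed because \<open>j - 1\<close> equals \<open>j\<close> for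
    \<open>j = 0\<close>, where the induction hypothesis says nothing.\<close>
  have "\<exists>M. j > 0 \<longrightarrow> ?P M (T * Suc N) (j - 1)"
  proof (cases "j > 0")
    case True
    then have "j - 1 < j" by simp
    from less.IH[OF this, of "T * Suc N"] show ?thesis by (rule ex_forward) (rule impI)
  qed simp
  then obtain M where M: "j > 0 \<longrightarrow> ?P M (T * Suc N) (j - 1)" by (rule exE)
  have "?P (max M T) T j"
  proof (intro allI impI)
    fix r :: "'a rel" and V h and c :: "'a \<Rightarrow> nat"
    assume bb: "bounded_branching r V h" and c: "c ` V \<subseteq> {..<T}"
      and pot: "real (bounded_branching.potential r V c) \<le> real j * (\<delta> * card V)"
    interpret bounded_branching r V h by fact
    obtain c' D where
      c': "c' ` V \<subseteq> {..<T * Suc N}" and D: "D \<subseteq> V" "potential c' + card D \<le> potential c"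
      and g: "\<And>i. good (\<eta> T) {v\<in>V - D. c v = i} \<or> real (card {v\<in>V - D. c v = i}) < \<theta> T * card V"
      by (rule refine_colouring[OF pos N c]) blast
    show "\<exists>t\<le>max M T. \<exists>(c :: 'a \<Rightarrow> nat) D. c ` V \<subseteq> {..<t} \<and> D \<subseteq> V \<and> real (card D) \<le> \<delta> * card V \<and>
       (\<forall>i. good (\<eta> t) {v\<in>V - D. c v = i} \<or> real (card {v\<in>V - D. c v = i}) < \<theta> t * card V)"
    proof (cases "real (card D) \<le> \<delta> * card V")
      case True
      then show ?thesis using c D(1) g by (intro exI[of _ T]) auto
    next
      case False
      \<comment> \<open>With an empty budget the potential is 0, so nothing can be split
        off.\<close>
      have "j > 0"
      proof (rule ccontr)
        assume "\<not> j > 0"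
        then have "card D = 0" using pot D(2) by simp
        then show False using False \<open>\<delta> > 0\<close> by simp
      qed
      moreover have "real (potential c') \<le> real (j - 1) * (\<delta> * card V)"
        using pot D(2) False \<open>j > 0\<close> by (simp add: of_nat_diff algebra_simps)
      ultimately obtain t c'' D'' where "t \<le> M" "c'' ` V \<subseteq> {..<t} \<and> D'' \<subseteq> V \<and> real (card D'') \<le> \<delta> * card V \<and>
       (\<forall>i. good (\<eta> t) {v\<in>V - D''. c'' v = i} \<or> real (card {v\<in>V - D''. c'' v = i}) < \<theta> t * card V)"
        using M[rule_format, OF \<open>j > 0\<close> bb c'] by blast
      then show ?thesis by (intro exI[of _ t]) auto
    qed
  qed
  then show ?case by blast
qed

text \<open>Starting from a single colour, all ranks are at most \<open>h\<close>, so a budget of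
  \<open>h / \<delta>\<close> units, rounded up, suffices.\<close>

lemma good_colouring:
  fixes \<delta> :: real and \<eta> \<theta> :: "nat \<Rightarrow> real"
  assumes "\<And>t. \<eta> t > 0" "\<And>t. \<theta> t > 0" "\<delta> > 0"
  shows "\<exists>M. \<forall>(r :: 'a rel) V. bounded_branching r V h \<longrightarrow>
     (\<exists>t\<le>M. \<exists>(c :: 'a \<Rightarrow> nat) D. c ` V \<subseteq> {..<t} \<and> D \<subseteq> V \<and> real (card D) \<le> \<delta> * card V \<and>
       (\<forall>i. bounded_branching.good r V (\<eta> t) {v\<in>V - D. c v = i} \<or>
            real (card {v\<in>V - D. c v = i}) < \<theta> t * card V))"
proof -
  obtain j :: nat where "real j > real h / \<delta>" using reals_Archimedean2 by blast
  then have j: "real h \<le> real j * \<delta>" using \<open>\<delta> > 0\<close> by (simp add: field_simps)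
  have pot: "real (bounded_branching.potential r V (\<lambda>_. 0)) \<le> real j * (\<delta> * card V)"
    if "bounded_branching r V h" for r :: "'a rel" and V
  proof -
    interpret bounded_branching r V h by fact
    have "potential (\<lambda>_. 0) \<le> (\<Sum>v\<in>V. h)"
      unfolding potential_def by (intro sum_mono rk_le) auto
    then have "real (potential (\<lambda>_. 0)) \<le> real (\<Sum>v\<in>V. h)" by (rule of_nat_mono)
    also have "\<dots> = real h * card V" by simp
    also have "\<dots> \<le> real j * \<delta> * card V" using j by (intro mult_right_mono) auto
    finally show ?thesis by simp
  qed
  have img: "(\<lambda>_. 0) ` V \<subseteq> {..<Suc 0}" for V :: "'a set" by auto
  show ?thesis
  proof (rule ex_forward[OF good_colouring_bounded_potential[of \<eta> \<theta> \<delta> "Suc 0" j, where ?'a = 'a, OF assms]],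
      intro allI impI)
    fix M and r :: "'a rel" and V
    assume M: "\<forall>(r :: 'a rel) V h (c :: 'a \<Rightarrow> nat). bounded_branching r V h \<longrightarrow> c ` V \<subseteq> {..<Suc 0} \<longrightarrow>
        real (bounded_branching.potential r V c) \<le> real j * (\<delta> * card V) \<longrightarrow>
        (\<exists>t\<le>M. \<exists>(c :: 'a \<Rightarrow> nat) D. c ` V \<subseteq> {..<t} \<and> D \<subseteq> V \<and> real (card D) \<le> \<delta> * card V \<and>
          (\<forall>i. bounded_branching.good r V (\<eta> t) {v\<in>V - D. c v = i} \<or>
               real (card {v\<in>V - D. c v = i}) < \<theta> t * card V))"
      and "bounded_branching r V h"
    show "\<exists>t\<le>M. \<exists>(c :: 'a \<Rightarrow> nat) D. c ` V \<subseteq> {..<t} \<and> D \<subseteq> V \<and> real (card D) \<le> \<delta> * card V \<and>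
          (\<forall>i. bounded_branching.good r V (\<eta> t) {v\<in>V - D. c v = i} \<or>
               real (card {v\<in>V - D. c v = i}) < \<theta> t * card V)"
      by (rule M[rule_format, OF \<open>bounded_branching r V h\<close> img pot[OF \<open>bounded_branching r V h\<close>]])
  qed
qed

section \<open>From good pairs to small discrepancy\<close>

lemma edge_count_mono:
  "finite X \<Longrightarrow> finite Y \<Longrightarrow> X' \<subseteq> X \<Longrightarrow> Y' \<subseteq> Y \<Longrightarrow> edge_count G X' Y' \<le> edge_count G X Y"
  unfolding edge_count_def by (rule card_mono) (auto intro: finite_subset[of _ "X \<times> Y"])

lemma edge_count_add_non_edges:
  assumes "finite X" "finite Y"
  shows "real (edge_count G X Y) + card {(x, y) \<in> X \<times> Y. (x, y) \<notin> parcs G} = real (card X) * card Y"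
proof -
  have "card ({(x, y) \<in> X \<times> Y. (x, y) \<in> parcs G} \<union> {(x, y) \<in> X \<times> Y. (x, y) \<notin> parcs G}) =
      edge_count G X Y + card {(x, y) \<in> X \<times> Y. (x, y) \<notin> parcs G}"
    unfolding edge_count_def
    by (rule card_Un_disjoint) (auto intro: finite_subset[OF _ finite_cartesian_product[OF assms]])
  moreover have "{(x, y) \<in> X \<times> Y. (x, y) \<in> parcs G} \<union> {(x, y) \<in> X \<times> Y. (x, y) \<notin> parcs G} = X \<times> Y" by auto
  ultimately show ?thesis by (simp add: card_cartesian_product flip: of_nat_add of_nat_mult)
qed

text \<open>Both the true and the expected number of edges between \<open>X'\<close> and
  \<open>Y'\<close> lie between 0 and \<open>edge_count G X Y\<close>.\<close>

lemma disc2_if_few_edges: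
  fixes \<delta> :: real
  assumes "finite X" "finite Y" "X \<noteq> {}" "Y \<noteq> {}"
    and "real (edge_count G X Y) \<le> \<delta> * card X * card Y"
  shows "disc2 G \<delta> X Y"
  unfolding disc2_def
proof (intro allI impI)
  fix X' Y' assume sub: "X' \<subseteq> X" "Y' \<subseteq> Y"
  have pos: "real (card X) * card Y > 0" using assms by (simp add: card_gt_0_iff)
  have "real (card X') * card Y' \<le> real (card X) * card Y"
    using sub assms by (intro mult_mono) (auto simp: card_mono)
  then have "edge_density G X Y * (real (card X') * card Y') \<le> edge_density G X Y * (real (card X) * card Y)"
    by (intro mult_left_mono) (auto simp: edge_density_def)
  also have "\<dots> = edge_count G X Y" using pos by (auto simp: edge_density_def)
  finally have "edge_density G X Y * (real (card X') * card Y') \<le> edge_count G X Y" .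
  moreover have "edge_density G X Y * (real (card X') * card Y') \<ge> 0" by (simp add: edge_density_def)
  moreover have "edge_count G X' Y' \<le> edge_count G X Y" using edge_count_mono assms sub by blast
  ultimately show "\<bar>real (edge_count G X' Y') - edge_density G X Y * real (card X') * real (card Y')\<bar>
          \<le> \<delta> * real (card X) * real (card Y)"
    using assms(5) unfolding mult.assoc by linarith
qed

lemma disc2_if_few_non_edges:
  fixes \<delta> :: real
  assumes fin: "finite X" "finite Y" "X \<noteq> {}" "Y \<noteq> {}"
    and le: "real (card {(x, y) \<in> X \<times> Y. (x, y) \<notin> parcs G}) \<le> \<delta> * card X * card Y"
  shows "disc2 G \<delta> X Y"
  unfolding disc2_def
proof (intro allI impI)
  fix X' Y' assume sub: "X' \<subseteq> X" "Y' \<subseteq> Y"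
  define ne where "ne = (\<lambda>X Y. real (card {(x, y) \<in> X \<times> Y. (x, y) \<notin> parcs G}))"
  have pos: "real (card X) * card Y > 0" using assms by (simp add: card_gt_0_iff)
  have prod: "real (card X') * card Y' \<le> real (card X) * card Y"
    using sub assms by (intro mult_mono) (auto simp: card_mono)
  have d: "(1 - edge_density G X Y) * (real (card X) * card Y) = ne X Y"
  proof -
    have "edge_density G X Y * (real (card X) * card Y) = edge_count G X Y"
      using pos by (auto simp: edge_density_def)
    then show ?thesis
      using edge_count_add_non_edges[OF fin(1,2), of G] by (simp add: ne_def left_diff_distrib)
  qed
  have "ne X Y \<ge> 0" by (simp add: ne_def)
  with d have d0: "1 - edge_density G X Y \<ge> 0" using pos by (metis mult_less_0_iff not_le)
  have "(1 - edge_density G X Y) * (real (card X') * card Y') \<le> ne X Y"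
    unfolding d[symmetric] using prod d0 by (rule mult_left_mono)
  moreover have "(1 - edge_density G X Y) * (real (card X') * card Y') \<ge> 0" using d0 by simp
  moreover have "ne X' Y' \<le> ne X Y"
    unfolding ne_def of_nat_le_iff using sub fin(1,2)
    by (intro card_mono) (auto intro: finite_subset[of _ "X \<times> Y"])
  moreover have "ne X' Y' \<ge> 0" by (simp add: ne_def)
  \<comment> \<open>Passing to non-edges only changes the sign of the deviation, so the argument for
    few edges applies.\<close>
  moreover have "real (edge_count G X' Y') - edge_density G X Y * (real (card X') * card Y') =
      (1 - edge_density G X Y) * (real (card X') * card Y') - ne X' Y'"
    using edge_count_add_non_edges[OF finite_subset[OF sub(1) fin(1)] finite_subset[OF sub(2) fin(2)], of G]
    by (simp add: ne_def left_diff_distrib)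
  ultimately show "\<bar>real (edge_count G X' Y') - edge_density G X Y * real (card X') * real (card Y')\<bar>
          \<le> \<delta> * real (card X) * real (card Y)"
    using le unfolding mult.assoc ne_def by linarith
qed

lemma card_Collect_Times_fst:
  assumes "finite X" "finite Y"
  shows "card {(x, y) \<in> X \<times> Y. P x y} = (\<Sum>x\<in>X. card {y\<in>Y. P x y})"
proof -
  have "{(x, y) \<in> X \<times> Y. P x y} = (SIGMA x:X. {y\<in>Y. P x y})" by auto
  then show ?thesis using assms by (simp add: card_SigmaI)
qed

lemma card_Collect_Times_snd:
  assumes "finite X" "finite Y"
  shows "card {(x, y) \<in> X \<times> Y. P x y} = (\<Sum>y\<in>Y. card {x\<in>X. P x y})"
proof -
  have "{(y, x) \<in> Y \<times> X. P x y} = prod.swap ` {(x, y) \<in> X \<times> Y. P x y}" by auto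
  moreover have "card (prod.swap ` {(x, y) \<in> X \<times> Y. P x y}) = card {(x, y) \<in> X \<times> Y. P x y}"
    by (rule card_image) (rule inj_on_subset[OF inj_swap subset_UNIV])
  ultimately show ?thesis
    using card_Collect_Times_fst[OF assms(2,1), of "\<lambda>y x. P x y"] by simp
qed

text \<open>Let \<open>Y1\<close> be the vertices of \<open>Y\<close> adjacent to almost all of
  \<open>X\<close>. As \<open>X\<close> is good, adjacency differs from membership in
  \<open>Y1\<close> on at most an \<open>\<eta>\<close> fraction of the pairs. By averaging, some
  \<open>x\<close> sees \<open>Y1\<close> in \<open>Y\<close> up to an error \<open>\<eta>\<close>;
  as \<open>Y\<close> is good, \<open>x\<close> sees almost nothing or almost everything. So
  \<open>Y1\<close> or its complement in \<open>Y\<close> has at most a \<open>2 * \<eta>\<close>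
  share, and the two errors add up to \<open>3 * \<eta>\<close>.\<close>

lemma good_pair_disc2:
  fixes G :: "'a pair_pre_digraph"
  assumes "bounded_branching (parcs G) (pverts G) h" and sym: "sym (parcs G)"
    and sub: "X \<subseteq> pverts G" "Y \<subseteq> pverts G" and ne: "X \<noteq> {}" "Y \<noteq> {}"
    and gX: "bounded_branching.good (parcs G) (pverts G) \<eta> X"
    and gY: "bounded_branching.good (parcs G) (pverts G) \<eta> Y"
  shows "disc2 G (3 * \<eta>) X Y"
proof -
  interpret bounded_branching "parcs G" "pverts G" h by fact
  have fin: "finite X" "finite Y" using sub finite_V finite_subset by blast+
  define Y1 where "Y1 = {y\<in>Y. real (card {x\<in>X. (x, y) \<notin> parcs G}) \<le> \<eta> * card X}"
  have Y1: "Y1 \<subseteq> Y" "finite Y1" using fin by (auto simp: Y1_def)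
  define err where "err = card {(x, y) \<in> X \<times> Y. ((x, y) \<in> parcs G) \<noteq> (y \<in> Y1)}"
  have "real (card {x\<in>X. ((x, y) \<in> parcs G) \<noteq> (y \<in> Y1)}) \<le> \<eta> * card X" if "y \<in> Y" for y
  proof (cases "y \<in> Y1")
    case True
    then show ?thesis by (simp add: Y1_def)
  next
    case False
    then have "\<not> real (card {x\<in>X. (x, y) \<notin> parcs G}) \<le> \<eta> * card X" using that by (simp add: Y1_def)
    then have "real (card {x\<in>X. (x, y) \<in> parcs G}) \<le> \<eta> * card X"
      using gX that sub(2) unfolding good_def by blast
    then show ?thesis using False by simp
  qed
  then have "(\<Sum>y\<in>Y. real (card {x\<in>X. ((x, y) \<in> parcs G) \<noteq> (y \<in> Y1)})) \<le> (\<Sum>y\<in>Y. \<eta> * card X)"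
    by (rule sum_mono)
  then have err: "real err \<le> \<eta> * card X * card Y"
    unfolding err_def card_Collect_Times_snd[OF fin] by (simp add: mult_ac)
  have "\<exists>x\<in>X. real (card {y\<in>Y. ((x, y) \<in> parcs G) \<noteq> (y \<in> Y1)}) \<le> \<eta> * card Y"
  proof (rule ccontr)
    assume "\<not> ?thesis"
    then have "\<And>x. x \<in> X \<Longrightarrow> \<eta> * card Y < real (card {y\<in>Y. ((x, y) \<in> parcs G) \<noteq> (y \<in> Y1)})"
      by (meson not_le)
    then have "(\<Sum>x\<in>X. \<eta> * card Y) < (\<Sum>x\<in>X. real (card {y\<in>Y. ((x, y) \<in> parcs G) \<noteq> (y \<in> Y1)}))"
      using fin(1) ne(1) by (intro sum_strict_mono) auto
    also have "\<dots> = real err" unfolding err_def card_Collect_Times_fst[OF fin] by simp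
    finally show False using err by (simp add: mult_ac)
  qed
  then obtain x where x: "x \<in> X" "real (card {y\<in>Y. ((x, y) \<in> parcs G) \<noteq> (y \<in> Y1)}) \<le> \<eta> * card Y"
    by blast
  let ?D = "{y\<in>Y. ((x, y) \<in> parcs G) \<noteq> (y \<in> Y1)}"
  \<comment> \<open>Goodness of \<open>Y\<close> has the tested vertex in the second coordinate,
    while \<open>x\<close> stands in the first.\<close>
  have "(y, x) \<in> parcs G \<longleftrightarrow> (x, y) \<in> parcs G" for y using sym by (auto dest: symD)
  then consider "real (card {y\<in>Y. (x, y) \<in> parcs G}) \<le> \<eta> * card Y"
    | "real (card {y\<in>Y. (x, y) \<notin> parcs G}) \<le> \<eta> * card Y"
    using gY[unfolded good_def, rule_format, of x] x(1) sub(1) by auto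
  then show ?thesis
  proof cases
    case 1
    have "card Y1 \<le> card ({y\<in>Y. (x, y) \<in> parcs G} \<union> ?D)"
      using Y1 fin by (intro card_mono) auto
    also have "\<dots> \<le> card {y\<in>Y. (x, y) \<in> parcs G} + card ?D" by (rule card_Un_le)
    finally have "real (card Y1) \<le> 2 * \<eta> * card Y" using 1 x(2) by linarith
    then have "real (card X) * card Y1 \<le> real (card X) * (2 * \<eta> * card Y)" by (intro mult_left_mono) auto
    moreover have "edge_count G X Y \<le> card ({(x, y) \<in> X \<times> Y. ((x, y) \<in> parcs G) \<noteq> (y \<in> Y1)} \<union> X \<times> Y1)"
      unfolding edge_count_def using fin Y1
      by (intro card_mono) (auto intro: finite_subset[of _ "X \<times> Y"])
    moreover have "\<dots> \<le> err + card X * card Y1"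
      unfolding err_def card_cartesian_product[symmetric] by (rule card_Un_le)
    ultimately have "edge_count G X Y \<le> err + card X * card Y1" by linarith
    then have "real (edge_count G X Y) \<le> real (err + card X * card Y1)" by (rule of_nat_mono)
    then have "real (edge_count G X Y) \<le> 3 * \<eta> * card X * card Y"
      using err \<open>real (card X) * card Y1 \<le> _\<close> by (simp add: algebra_simps)
    then show ?thesis by (intro disc2_if_few_edges fin ne) simp
  next
    case 2
    have "card (Y - Y1) \<le> card ({y\<in>Y. (x, y) \<notin> parcs G} \<union> ?D)"
      using Y1 fin by (intro card_mono) auto
    also have "\<dots> \<le> card {y\<in>Y. (x, y) \<notin> parcs G} + card ?D" by (rule card_Un_le)
    finally have "real (card (Y - Y1)) \<le> 2 * \<eta> * card Y" using 2 x(2) by linarith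
    then have "real (card X) * card (Y - Y1) \<le> real (card X) * (2 * \<eta> * card Y)" by (intro mult_left_mono) auto
    moreover have "card {(x, y) \<in> X \<times> Y. (x, y) \<notin> parcs G} \<le>
        card ({(x, y) \<in> X \<times> Y. ((x, y) \<in> parcs G) \<noteq> (y \<in> Y1)} \<union> X \<times> (Y - Y1))"
      using fin Y1 by (intro card_mono) (auto intro: finite_subset[of _ "X \<times> Y"])
    moreover have "\<dots> \<le> err + card X * card (Y - Y1)"
      unfolding err_def card_cartesian_product[symmetric] by (rule card_Un_le)
    ultimately have "card {(x, y) \<in> X \<times> Y. (x, y) \<notin> parcs G} \<le> err + card X * card (Y - Y1)" by linarith
    then have "real (card {(x, y) \<in> X \<times> Y. (x, y) \<notin> parcs G}) \<le> real (err + card X * card (Y - Y1))"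
      by (rule of_nat_mono)
    then have "real (card {(x, y) \<in> X \<times> Y. (x, y) \<notin> parcs G}) \<le> 3 * \<eta> * card X * card Y"
      using err \<open>real (card X) * card (Y - Y1) \<le> _\<close> by (simp add: algebra_simps)
    then show ?thesis by (intro disc2_if_few_non_edges fin ne) simp
  qed
qed

text \<open>The density is 0 or 1, so edges or non-edges are absent. This handles graphs of bounded
  order, which are partitioned into single vertices.\<close>

lemma disc2_singletons:
  assumes "\<delta> \<ge> 0"
  shows "disc2 G \<delta> {x} {y}"
proof (cases "(x, y) \<in> parcs G")
  case True
  then have "{(u, v) \<in> {x} \<times> {y}. (u, v) \<notin> parcs G} = {}" by auto
  then have "card {(u, v) \<in> {x} \<times> {y}. (u, v) \<notin> parcs G} = 0" by (simp only: card.empty)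
  then show ?thesis using assms by (intro disc2_if_few_non_edges) simp_all
next
  case False
  then have "{(u, v) \<in> {x} \<times> {y}. (u, v) \<in> parcs G} = {}" by auto
  then have "edge_count G {x} {y} = 0" by (simp only: edge_count_def card.empty)
  then show ?thesis using assms by (intro disc2_if_few_edges) simp_all
qed

section \<open>Cutting classes into equal blocks\<close>

text \<open>In a largest family of disjoint blocks, no class has more than \<open>q\<close>
  uncovered vertices, since otherwise another block would fit.\<close>

lemma exists_equal_blocks:
  assumes "finite V" "c ` (V - D) \<subseteq> {..<t}" "D \<subseteq> V" "q > 0"
  shows "\<exists>P. disjoint P \<and> (\<forall>B\<in>P. card B = q \<and> (\<exists>i. B \<subseteq> {v\<in>V - D. c v = i})) \<and>
     card (V - \<Union>P) \<le> card D + t * q"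
proof -
  let ?Q = "\<lambda>P. disjoint P \<and> (\<forall>B\<in>P. card B = q \<and> (\<exists>i. B \<subseteq> {v\<in>V - D. c v = (i :: nat)}))"
  have "card P < Suc (card (Pow V))" if "?Q P" for P
    using that assms(1) by (intro le_imp_less_Suc card_mono) auto
  moreover have "?Q {}" by simp
  ultimately obtain P where P: "?Q P" and max: "\<And>P'. ?Q P' \<Longrightarrow> card P' \<le> card P"
    using ex_has_greatest_nat[of ?Q "{}" card "Suc (card (Pow V))"] by blast
  have "finite P" by (rule finite_subset[of _ "Pow V"]) (use P assms(1) in auto)
  have "card ({v\<in>V - D. c v = i} - \<Union>P) \<le> q" for i
  proof (rule ccontr)
    assume "\<not> ?thesis"
    then obtain B where B: "B \<subseteq> {v\<in>V - D. c v = i} - \<Union>P" "card B = q"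
      by (meson nle_le obtain_subset_with_card_n)
    \<comment> \<open>Being nonempty and disjoint from the union, \<open>B\<close> is not yet in
      \<open>P\<close>, so inserting it really enlarges the family.\<close>
    then have "B \<noteq> {}" using assms(4) by auto
    then have "B \<notin> P" using B(1) by auto
    moreover have "B \<subseteq> {v\<in>V - D. c v = i}" using B(1) by blast
    then have "?Q (insert B P)" using P B by (auto simp: disjoint_def simp del: Diff_iff)
    ultimately show False using max[of "insert B P"] \<open>finite P\<close> by simp
  qed
  then have "(\<Sum>i<t. card ({v\<in>V - D. c v = i} - \<Union>P)) \<le> (\<Sum>i<t. q)" by (intro sum_mono)
  moreover have "card (\<Union>i<t. {v\<in>V - D. c v = i} - \<Union>P) \<le> (\<Sum>i<t. card ({v\<in>V - D. c v = i} - \<Union>P))"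
    by (rule card_UN_le) simp
  moreover have "card (V - \<Union>P) \<le> card (D \<union> (\<Union>i<t. {v\<in>V - D. c v = i} - \<Union>P))"
    using assms finite_subset[OF assms(3,1)] by (intro card_mono) auto
  moreover have "\<dots> \<le> card D + card (\<Union>i<t. {v\<in>V - D. c v = i} - \<Union>P)" by (rule card_Un_le)
  ultimately have "card (V - \<Union>P) \<le> card D + t * q" by simp
  then show ?thesis using P by blast
qed

lemma exceptional_partition_of_blocks:
  assumes "finite V" "disjoint P" "\<Union>P \<subseteq> V" "{} \<notin> P"
  obtains W where "exceptional_partition V (card P) W" "W 0 = V - \<Union>P" "\<And>i. i \<in> {1..card P} \<Longrightarrow> W i \<in> P"
proof -
  have "finite P" using assms by (meson finite_UnionD finite_subset)
  then obtain g where "bij_betw g {0..<card P} P" using ex_bij_betw_nat_finite by blast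
  then have g: "g ` {0..<card P} = P" "inj_on g {0..<card P}" by (auto simp: bij_betw_def)
  define W where "W = (\<lambda>i. case i of 0 \<Rightarrow> V - \<Union>P | Suc n \<Rightarrow> g n)"
  have WP: "W i \<in> P" if "i \<in> {1..card P}" for i
    using that g(1) by (cases i) (auto simp: W_def)
  have "exceptional_partition V (card P) W"
    unfolding exceptional_partition_def
  proof (intro conjI ballI)
    have img: "W ` {1..card P} = P"
    proof -
      have eq: "{1..card P} = Suc ` {0..<card P}"
        by (simp add: image_Suc_atLeastLessThan atLeastLessThanSuc_atLeastAtMost)
      show ?thesis unfolding eq image_image using g(1) by (simp add: W_def)
    qed
    have "{0..card P} = insert 0 {1..card P}" by auto
    then have "(\<Union>i\<in>{0..card P}. W i) = W 0 \<union> \<Union>P" using img by simp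
    then show "V = (\<Union>i\<in>{0..card P}. W i)" using assms(3) by (auto simp: W_def)
    show "disjoint_family_on W {0..card P}"
      unfolding disjoint_family_on_def
    proof (intro ballI impI)
      fix i j assume ij: "i \<in> {0..card P}" "j \<in> {0..card P}" "i \<noteq> j"
      show "W i \<inter> W j = {}"
      proof (cases "i = 0 \<or> j = 0")
        case True
        then show ?thesis using ij WP[of i] WP[of j] by (auto simp: W_def)
      next
        case False
        then obtain i' j' where "i = Suc i'" "j = Suc j'" by (metis not0_implies_Suc)
        then have "W i \<noteq> W j" using ij g(2) by (auto simp: W_def inj_on_def)
        then show ?thesis using WP[of i] WP[of j] ij False assms(2) by (auto simp: disjoint_def)
      qed
    qed
    fix i assume "i \<in> {1..card P}"
    then show "W i \<noteq> {}" using WP assms(4) by metis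
  qed
  then show thesis using that[of W] WP by (auto simp: W_def)
qed

section \<open>Choice of parameters and assembly\<close>

theorem theorem5p7:
  fixes k :: nat and \<epsilon> :: real and f :: "nat \<Rightarrow> real"
  assumes "k \<ge> 1" and "\<epsilon> > 0"
    and "antimono f" and "\<forall>n. 0 < f n \<and> f n \<le> 1"
  shows "\<exists>M :: nat. \<forall>G :: 'a pair_pre_digraph.
           pair_graph G \<longrightarrow> stable_graph k G \<longrightarrow>
           (\<exists>m W. m \<le> M \<and> exceptional_partition (pverts G) m W \<and>
              real (card (W 0)) \<le> \<epsilon> * real (card (pverts G)) \<and>
              (\<forall>i\<in>{1..m}. \<forall>j\<in>{1..m}.
                 disc2 G (f m) (W i) (W j) \<and> card (W i) = card (W j)))"
proof -
  \<comment> \<open>Blocks will have between \<open>\<theta> t\<close> and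
    \<open>2 * \<theta> t\<close> times \<open>card V\<close> vertices, so the leftovers of
    \<open>t\<close> classes cost at most half of \<open>\<epsilon>\<close>; \<open>D\<close> takes
    the other half. \<open>\<mu> t\<close> is the inverse of \<open>\<theta> t\<close> rounded up
    and bounds the number of blocks. In \<open>\<eta> t\<close>, the factor
    \<open>\<theta> t\<close> pays for passing from a class to a block, and the 3 for
    \<open>good_pair_disc2\<close>.\<close>
  define \<theta> :: "nat \<Rightarrow> real" where "\<theta> = (\<lambda>t. \<epsilon> / (8 * (real t + 1)))"
  define \<mu> :: "nat \<Rightarrow> nat" where "\<mu> = (\<lambda>t. nat \<lceil>8 * (real t + 1) / \<epsilon>\<rceil>)"
  define \<eta> :: "nat \<Rightarrow> real" where "\<eta> = (\<lambda>t. \<theta> t * f (\<mu> t) / 3)"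
  have \<theta>: "\<theta> t > 0" and \<eta>: "\<eta> t > 0" for t
    using assms(2,4) by (auto simp: \<theta>_def \<eta>_def add_nonneg_pos)
  obtain M0 where M0: "\<And>(r :: 'a rel) V. bounded_branching r V (hodges_height k) \<Longrightarrow>
     (\<exists>t\<le>M0. \<exists>(c :: 'a \<Rightarrow> nat) D. c ` V \<subseteq> {..<t} \<and> D \<subseteq> V \<and> real (card D) \<le> \<epsilon> / 2 * card V \<and>
       (\<forall>i. bounded_branching.good r V (\<eta> t) {v\<in>V - D. c v = i} \<or>
            real (card {v\<in>V - D. c v = i}) < \<theta> t * card V))"
    using good_colouring[of \<eta> \<theta> "\<epsilon> / 2" "hodges_height k", where ?'a = 'a, OF \<eta> \<theta>] assms(2)
    by (meson half_gt_zero)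
  have \<mu>_mono: "\<mu> t \<le> \<mu> M0" if "t \<le> M0" for t
    unfolding \<mu>_def using that assms(2) by (intro nat_mono ceiling_mono divide_right_mono) auto
  show ?thesis
  \<comment> \<open>The number \<open>t\<close> of colours depends on the graph, but
    \<open>t \<le> M0\<close> and \<open>\<mu>\<close> is monotone.\<close>
  proof (rule exI[of _ "\<mu> M0"], intro allI impI)
    fix G :: "'a pair_pre_digraph"
    assume G: "pair_graph G" "stable_graph k G"
    interpret G: pair_graph G by fact
    let ?V = "pverts G"
    have bb: "bounded_branching (parcs G) ?V (hodges_height k)"
      using stable_graph_not_branching[OF G(2)] by unfold_locales auto
    interpret bounded_branching "parcs G" ?V "hodges_height k" by (rule bb)
    have sym: "sym (parcs G)" using G.sym_arcs by (simp add: symmetric_def)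
    have blocks: "\<exists>m W. m \<le> \<mu> M0 \<and> exceptional_partition ?V m W \<and>
              real (card (W 0)) \<le> \<epsilon> * real (card ?V) \<and>
              (\<forall>i\<in>{1..m}. \<forall>j\<in>{1..m}. disc2 G (f m) (W i) (W j) \<and> card (W i) = card (W j))"
      if P: "disjoint P" "\<Union>P \<subseteq> ?V" "\<And>B. B \<in> P \<Longrightarrow> card B = q" "q > 0" "card P \<le> \<mu> M0"
        "real (card (?V - \<Union>P)) \<le> \<epsilon> * card ?V" "\<And>X Y. X \<in> P \<Longrightarrow> Y \<in> P \<Longrightarrow> disc2 G (f (card P)) X Y"
      for P q
    proof -
      have "{} \<notin> P" using P(3)[of "{}"] P(4) by auto
      obtain W where
        W: "exceptional_partition ?V (card P) W" "W 0 = ?V - \<Union>P" "\<And>i. i \<in> {1..card P} \<Longrightarrow> W i \<in> P"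
        by (rule exceptional_partition_of_blocks[OF finite_V P(1,2) \<open>{} \<notin> P\<close>]) blast
      show ?thesis
      proof (intro exI[of _ "card P"] exI[of _ W] conjI ballI)
        show "real (card (W 0)) \<le> \<epsilon> * real (card ?V)" using W(2) P(6) by simp
        fix i j assume ij: "i \<in> {1..card P}" "j \<in> {1..card P}"
        show "disc2 G (f (card P)) (W i) (W j)" using P(7)[OF W(3)[OF ij(1)] W(3)[OF ij(2)]] .
        show "card (W i) = card (W j)" using P(3)[OF W(3)[OF ij(1)]] P(3)[OF W(3)[OF ij(2)]] by simp
      qed (use P(5) W(1) in auto)
    qed
    obtain t c D where t: "t \<le> M0" "c ` ?V \<subseteq> {..<t}" "D \<subseteq> ?V" "real (card D) \<le> \<epsilon> / 2 * card ?V"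
      and gd: "\<And>i. good (\<eta> t) {v\<in>?V - D. c v = (i::nat)} \<or> real (card {v\<in>?V - D. c v = i}) < \<theta> t * card ?V"
      using M0[OF bb] by blast
    \<comment> \<open>The factor 2 absorbs the rounding: once \<open>\<theta> t * card ?V\<close> is
      at least 1, \<open>q\<close> is at least that number.\<close>
    define q where "q = nat \<lfloor>2 * \<theta> t * card ?V\<rfloor>"
    show "\<exists>m W. m \<le> \<mu> M0 \<and> exceptional_partition ?V m W \<and>
              real (card (W 0)) \<le> \<epsilon> * real (card ?V) \<and>
              (\<forall>i\<in>{1..m}. \<forall>j\<in>{1..m}. disc2 G (f m) (W i) (W j) \<and> card (W i) = card (W j))"
    \<comment> \<open>Small graphs can afford one block per vertex; in large ones
      \<open>\<theta> t * card ?V\<close> is at least 1.\<close>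
    proof (cases "card ?V \<le> \<mu> M0")
      case True
      have "card ((\<lambda>v. {v}) ` ?V) = card ?V" by (simp add: card_image)
      then show ?thesis
        using True assms(2,4)
        by (intro blocks[of "(\<lambda>v. {v}) ` ?V" 1])
          (auto simp: disjoint_def intro!: disc2_singletons less_imp_le)
    next
      case False
      then have "card ?V > \<mu> t" using \<mu>_mono[OF t(1)] by simp
      then have "8 * (real t + 1) / \<epsilon> \<le> card ?V" unfolding \<mu>_def by linarith
      then have big: "1 \<le> \<theta> t * card ?V" using assms(2) by (simp add: \<theta>_def field_simps)
      then have q: "real q \<ge> \<theta> t * card ?V" "real q \<le> 2 * \<theta> t * card ?V" "q > 0"
        unfolding q_def by linarith+
      have cD: "c ` (?V - D) \<subseteq> {..<t}" using t(2) by auto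
      from exists_equal_blocks[OF finite_V cD t(3) q(3)] obtain P where P: "disjoint P"
        "\<And>B. B \<in> P \<Longrightarrow> card B = q" "\<And>B. B \<in> P \<Longrightarrow> \<exists>i. B \<subseteq> {v\<in>?V - D. c v = i}"
        "card (?V - \<Union>P) \<le> card D + t * q" by blast
      have PV: "B \<subseteq> ?V" if "B \<in> P" for B using P(3)[OF that] by blast
      have "card (\<Union>P) = (\<Sum>B\<in>P. card B)"
        using P(1) PV by (intro card_Union_disjoint) (auto simp: disjoint_def pairwise_def disjnt_def intro: finite_subset[OF PV finite_V])
      then have "card P * q = card (\<Union>P)" using P(2) by simp
      also have "\<dots> \<le> card ?V" using PV by (intro card_mono) auto
      finally have "card P * q \<le> card ?V" .
      then have "real (card P) * q \<le> card ?V" unfolding of_nat_mult[symmetric] by (rule of_nat_mono)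
      moreover have "real (card P) * (\<theta> t * card ?V) \<le> real (card P) * q"
        using q(1) by (intro mult_left_mono) auto
      ultimately have "(real (card P) * \<theta> t) * card ?V \<le> 1 * real (card ?V)" by simp
      moreover have "real (card ?V) > 0" using big by (cases "card ?V = 0") auto
      ultimately have "real (card P) * \<theta> t \<le> 1" by (metis mult_le_cancel_right_pos)
      then have "real (card P) \<le> 8 * (real t + 1) / \<epsilon>" using assms(2) by (simp add: \<theta>_def field_simps)
      then have cP: "card P \<le> \<mu> t" unfolding \<mu>_def by linarith
      show ?thesis
      proof (rule blocks[OF P(1) _ P(2) q(3)])
        show "\<Union>P \<subseteq> ?V" using PV by blast
        show "card P \<le> \<mu> M0" using cP \<mu>_mono[OF t(1)] by simp
        have "real t * q \<le> real t * (2 * \<theta> t * card ?V)" using q(2) by (intro mult_left_mono) auto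
        also have "\<dots> = (real t * (2 * \<theta> t)) * card ?V" by simp
        also have "\<dots> \<le> \<epsilon> / 2 * card ?V"
          using assms(2) by (intro mult_right_mono) (auto simp: \<theta>_def field_simps)
        finally have "real t * q \<le> \<epsilon> / 2 * card ?V" .
        moreover have "real (card (?V - \<Union>P)) \<le> card D + real t * q"
          unfolding of_nat_mult[symmetric] of_nat_add[symmetric] using P(4) by (rule of_nat_mono)
        ultimately show "real (card (?V - \<Union>P)) \<le> \<epsilon> * card ?V" using t(4) by simp
        have good: "good (f (\<mu> t) / 3) B" if B: "B \<in> P" for B
        proof -
          obtain i where i: "B \<subseteq> {v\<in>?V - D. c v = i}" using P(3)[OF B] by blast
          have le: "card B \<le> card {v\<in>?V - D. c v = i}" "card {v\<in>?V - D. c v = i} \<le> card ?V"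
            using i by (auto intro!: card_mono)
          \<comment> \<open>A class containing a block of size \<open>q\<close> is not below the
            threshold, so it must be good.\<close>
          then have "good (\<eta> t) {v\<in>?V - D. c v = i}" using gd[of i] q(1) P(2)[OF B] by linarith
          moreover have "\<eta> t * card {v\<in>?V - D. c v = i} \<le> \<eta> t * card ?V"
            using le(2) \<eta>[of t] by simp
          moreover have "\<eta> t * card ?V = f (\<mu> t) / 3 * (\<theta> t * card ?V)" by (simp add: \<eta>_def)
          moreover have "f (\<mu> t) / 3 * (\<theta> t * card ?V) \<le> f (\<mu> t) / 3 * card B"
            using q(1) P(2)[OF B] assms(4) by (intro mult_left_mono) (auto simp: less_imp_le)
          ultimately show ?thesis by (intro good_subset[OF _ i]) auto
        qed
        fix X Y assume XY: "X \<in> P" "Y \<in> P"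
        then have ne: "X \<noteq> {}" "Y \<noteq> {}" using P(2) q(3) by fastforce+
        have "disc2 G (3 * (f (\<mu> t) / 3)) X Y"
          by (rule good_pair_disc2[OF bb sym PV[OF XY(1)] PV[OF XY(2)] ne good[OF XY(1)] good[OF XY(2)]])
        then have "disc2 G (f (\<mu> t)) X Y" by simp
        \<comment> \<open>The final number of blocks is not known when \<open>\<eta>\<close> is
          chosen, only its bound \<open>\<mu> t\<close>; monotonicity of \<open>f\<close> bridges
          the gap.\<close>
        moreover have "f (\<mu> t) \<le> f (card P)" by (rule antimonoD[OF assms(3) cP])
        ultimately show "disc2 G (f (card P)) X Y"
          unfolding disc2_def by (meson mult_right_mono of_nat_0_le_iff order_trans)
      qed
    qed
  qed
qed

end
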